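(* Let $n\ge1$, let $\Pi\subset\mathbb{R}^n$ be a rectangular parallelepiped of volume $v_+$, divided by a barrier into two parts, and let $\Pi_-\subset\Pi$ be one of the parts, of volume $v_->0$. Suppose a collisionless gas is initially concentrated in $\Pi_-$ and is in heat balance there, with density $f_-:\mathbb{R}^n\to[0,\infty)$ depending only on the velocity $\omega$, normalized by $v_-\int_{\mathbb{R}^n}f_-(\omega)\,d^n\omega=1$, and with $f_-\ln f_-$ integrable on $\mathbb{R}^n$. Let $$S_-=-v_-\int_{\mathbb{R}^n}f_-(\omega)\ln f_-(\omega)\,d^n\omega$$ be its entropy. After removal of the barrier the density of the gas in $\Pi$ at the initial moment is $f(\omega,z)=f_-(\omega)$ for $z\in\Pi_-$ and $f(\omega,z)=0$ for $z\in\Pi\setminus\Pi_-$. Let $S_+$ be the entropy of the gas in $\Pi$ after the establishment of heat balance, i.e. $$S_+=-v_+\int_{\mathbb{R}^n}\overline{f}(\omega)\ln\overline{f}(\omega)\,d^n\omega,\qquad \overline{f}(\omega)=\frac{1}{v_+}\int_{\Pi}f(\omega,z)\,d^nz .$$ Then $$S_+=S_-+\ln\frac{v_+}{v_-}.$$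
   Context: The gas is a collisionless continuous medium: its particles do not interact, move with constant velocities inside the vessel and are reflected elastically from its walls. The entropy of a distribution with density $f$ is $-\int f\ln f$ over the phase space (positions in the vessel times velocities in $\mathbb{R}^n$), with $0\ln0=0$. The equilibrium (heat balance) density in the vessel $\Pi$ reached as $t\to\infty$ is the generalized (weak) limit of the evolving density, which equals the spatial average $\overline{f}$ of the initial density over $\Pi$. *)

theory Defs
  imports "HOL-Analysis.Analysis"
begin

text \<open>Any orientation is allowed; the translation is absorbed into the corners.\<close>

definition rectangular_parallelepiped :: "(real ^ 'n) set \<Rightarrow> bool" where
  "rectangular_parallelepiped P \<longleftrightarrow>
     (\<exists>(T :: real ^ 'n \<Rightarrow> real ^ 'n) a b. orthogonal_transformation T \<and> (\<forall>i. a $ i < b $ i) \<and> P = T ` cbox a b)"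

text \<open>Densities take the velocity first and the position second. The phase space of a gas
  in the vessel \<open>V\<close> is \<open>V \<times> \<real>\<^sup>n\<close>. The convention \<open>0 ln 0 = 0\<close>
  holds because \<open>0 * ln 0 = 0\<close> for \<^const>\<open>ln\<close> on the reals.\<close>

definition gas_entropy ::
  "(real ^ 'n) set \<Rightarrow> (real ^ 'n \<Rightarrow> real ^ 'n \<Rightarrow> real) \<Rightarrow> real" where
  "gas_entropy V f =
     - (\<integral>(z, \<omega>). f \<omega> z * ln (f \<omega> z) \<partial>(lebesgue_on V \<Otimes>\<^sub>M lebesgue))"

text \<open>The density of the gas in heat balance in the vessel \<open>V\<close>, as a function of the
  velocity, when the initial density is \<open>f\<close>.\<close>

definition spatial_average ::
  "(real ^ 'n) set \<Rightarrow> (real ^ 'n \<Rightarrow> real ^ 'n \<Rightarrow> real) \<Rightarrow> real ^ 'n \<Rightarrow> real" where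
  "spatial_average V f \<omega> = 1 / measure lebesgue V * (\<integral>z. f \<omega> z \<partial>lebesgue_on V)"

lemma gas_entropy_homogeneous:
  fixes V :: "(real ^ 'n) set" and g :: "real ^ 'n \<Rightarrow> real"
  assumes V: "V \<in> lmeasurable"
    and g: "integrable lebesgue (\<lambda>\<omega>. g \<omega> * ln (g \<omega>))"
  shows "gas_entropy V (\<lambda>\<omega> z. g \<omega>)
    = - measure lebesgue V * (\<integral>\<omega>. g \<omega> * ln (g \<omega>) \<partial>lebesgue)"
proof -
  let ?M = "lebesgue_on V" and ?N = "lebesgue :: (real ^ 'n) measure"
  let ?h = "\<lambda>\<omega>. g \<omega> * ln (g \<omega>)"
  interpret M: finite_measure ?M
    by (rule finite_measureI) (use V in \<open>auto simp: emeasure_restrict_space fmeasurable_def\<close>)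
  interpret N: sigma_finite_measure ?N
  proof
    obtain A :: "(real ^ 'n) set set" where A: "countable A" "A \<subseteq> sets lborel"
        "\<Union>A = space lborel" "\<forall>a\<in>A. emeasure lborel a \<noteq> \<infinity>"
      using lborel.sigma_finite_countable by blast
    show "\<exists>A. countable A \<and> A \<subseteq> sets ?N \<and> \<Union>A = space ?N \<and> (\<forall>a\<in>A. emeasure ?N a \<noteq> \<infinity>)"
      by (rule exI[of _ A]) (use A in \<open>auto simp: subset_iff\<close>)
  qed
  interpret P: pair_sigma_finite ?M ?N ..
  have meas: "?h \<in> borel_measurable ?N"
    using g by (rule borel_measurable_integrable)
  have int: "integrable (?M \<Otimes>\<^sub>M ?N) (\<lambda>x. ?h (snd x))"
    by (rule P.Fubini_integrable) (use g measurable_compose[OF measurable_snd meas] in auto)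
  have "(\<integral>(z, \<omega>). ?h \<omega> \<partial>(?M \<Otimes>\<^sub>M ?N)) = (\<integral>z. (\<integral>\<omega>. ?h \<omega> \<partial>?N) \<partial>?M)"
    using P.integral_fst'[OF int] by (simp add: case_prod_unfold)
  also have "\<dots> = measure lebesgue V * (\<integral>\<omega>. ?h \<omega> \<partial>?N)"
    using V by (simp add: measure_restrict_space space_restrict_space fmeasurableD)
  finally show ?thesis by (simp add: gas_entropy_def)
qed

end

theory Submission imports Defs begin

text \<open>The gas fills the fraction \<open>c = v_minus / v_plus\<close> of the vessel, so spatial
  averaging turns its density into \<open>c * f_minus\<close>
  (\<open>spatial_average_concentrated\<close>). Scaling gives
  \<open>(c x) ln (c x) = c x ln x + (c ln c) x\<close> (\<open>mult_ln_scale\<close>). Integrate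
  over velocities and multiply by \<open>- v_plus\<close>: since
  \<open>v_plus * c = v_minus\<close>, the first term becomes the old entropy, and by normalization
  the second becomes \<open>- ln c\<close>, the entropy gain. \<open>gas_entropy_homogeneous\<close>
  reduces both phase-space entropies to volume times a velocity integral.\<close>

lemma rectangular_parallelepiped_imp_lmeasurable:
  fixes P :: "(real ^ 'n) set"
  assumes "rectangular_parallelepiped P"
  shows "P \<in> lmeasurable"
proof -
  obtain T :: "real ^ 'n \<Rightarrow> real ^ 'n" and a b where T: "orthogonal_transformation T" and P: "P = T ` cbox a b"
    using assms unfolding rectangular_parallelepiped_def by blast
  \<comment> \<open>Compactness already yields finite volume, without computing how \<open>T\<close>
    acts on measure.\<close>
  have "compact P"
    unfolding P using T
    by (intro compact_continuous_image linear_continuous_on compact_cbox)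
      (simp add: orthogonal_transformation_linear linear_linear)
  then show ?thesis
    by (rule lmeasurable_compact)
qed

text \<open>At a fixed velocity the density agrees on \<open>V\<close> with \<open>c\<close> times
  the indicator of \<open>U\<close>.\<close>

lemma spatial_average_concentrated:
  assumes V: "V \<in> lmeasurable" and U: "U \<in> sets lebesgue" "U \<subseteq> V"
    and "\<And>z. z \<in> U \<Longrightarrow> f \<omega> z = c"
    and "\<And>z. z \<in> V - U \<Longrightarrow> f \<omega> z = 0"
  shows "spatial_average V f \<omega> = measure lebesgue U / measure lebesgue V * c"
proof -
  have "(\<integral>z. f \<omega> z \<partial>lebesgue_on V) = (\<integral>z. indicator U z * c \<partial>lebesgue_on V)"
    by (rule Bochner_Integration.integral_cong) (use assms in \<open>auto simp: indicator_def\<close>)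
  also have "\<dots> = measure lebesgue U * c"
    using V U by (simp add: measure_restrict_space fmeasurableD space_restrict_space Int_absorb2)
  finally show ?thesis
    by (simp add: spatial_average_def)
qed

lemma mult_ln_scale:
  fixes c x :: real
  assumes "c > 0" "x \<ge> 0"
  shows "c * x * ln (c * x) = c * (x * ln x) + c * ln c * x"
  \<comment> \<open>The product rule for \<open>ln\<close> fails at \<open>x = 0\<close>, but there
    the factor \<open>x\<close> makes both sides vanish.\<close>
  using assms by (cases "x = 0") (simp_all add: ln_mult algebra_simps)

theorem mainTheorem5:
  fixes Pi_plus Pi_minus :: "(real ^ 'n) set"
    and f_minus :: "real ^ 'n \<Rightarrow> real"
    and f :: "real ^ 'n \<Rightarrow> real ^ 'n \<Rightarrow> real"
    and v_plus v_minus S_plus S_minus :: real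
  assumes vessel: "rectangular_parallelepiped Pi_plus"
    and part: "Pi_minus \<in> sets lebesgue" "Pi_minus \<subseteq> Pi_plus"
    and volumes: "v_plus = measure lebesgue Pi_plus" "v_minus = measure lebesgue Pi_minus"
    and v_minus_pos: "v_minus > 0"
    and nonneg: "\<And>\<omega>. f_minus \<omega> \<ge> 0"
    and integrable: "integrable lebesgue f_minus"
    and normalized: "v_minus * (\<integral>\<omega>. f_minus \<omega> \<partial>lebesgue) = 1"
    and integrable_ln: "integrable lebesgue (\<lambda>\<omega>. f_minus \<omega> * ln (f_minus \<omega>))"
    and S_minus: "S_minus = gas_entropy Pi_minus (\<lambda>\<omega> z. f_minus \<omega>)"
    and initial_in: "\<And>\<omega> z. z \<in> Pi_minus \<Longrightarrow> f \<omega> z = f_minus \<omega>"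
    and initial_out: "\<And>\<omega> z. z \<in> Pi_plus - Pi_minus \<Longrightarrow> f \<omega> z = 0"
    and S_plus: "S_plus = gas_entropy Pi_plus (\<lambda>\<omega> z. spatial_average Pi_plus f \<omega>)"
  shows "S_plus = S_minus + ln (v_plus / v_minus)"
proof -
  define c where "c = v_minus / v_plus"
  have plus: "Pi_plus \<in> lmeasurable"
    by (rule rectangular_parallelepiped_imp_lmeasurable[OF vessel])
  have minus: "Pi_minus \<in> lmeasurable"
    using fmeasurableI2[OF plus] part by blast
  have "v_minus \<le> v_plus"
    \<comment> \<open>Monotonicity of volume transfers positivity from \<open>v_minus\<close> to
      \<open>v_plus\<close>, so that \<open>c\<close> is a genuine positive ratio.\<close>
    unfolding volumes using measure_mono_fmeasurable[OF part(2,1) plus] .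
  then have v_plus_pos: "v_plus > 0"
    using v_minus_pos by linarith
  have c_pos: "c > 0" and vc: "v_plus * c = v_minus"
    using v_minus_pos v_plus_pos by (simp_all add: c_def)
  have avg: "spatial_average Pi_plus f \<omega> = c * f_minus \<omega>" for \<omega>
    unfolding c_def volumes
    by (rule spatial_average_concentrated) (use plus part initial_in initial_out in auto)
  have ln_avg: "c * f_minus \<omega> * ln (c * f_minus \<omega>)
      = c * (f_minus \<omega> * ln (f_minus \<omega>)) + c * ln c * f_minus \<omega>" for \<omega>
    by (rule mult_ln_scale[OF c_pos nonneg])
  let ?I = "\<integral>\<omega>. f_minus \<omega> * ln (f_minus \<omega>) \<partial>lebesgue"
  \<comment> \<open>Integrability of the averaged integrand is what lets Fubini apply to
    \<open>S_plus\<close>; it follows from the splitting \<open>ln_avg\<close>.\<close>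
  have "integrable lebesgue (\<lambda>\<omega>. c * f_minus \<omega> * ln (c * f_minus \<omega>))"
    unfolding ln_avg using integrable integrable_ln by (intro Bochner_Integration.integrable_add integrable_mult_right)
  then have "S_plus = - v_plus * (\<integral>\<omega>. c * f_minus \<omega> * ln (c * f_minus \<omega>) \<partial>lebesgue)"
    unfolding S_plus avg volumes by (rule gas_entropy_homogeneous[OF plus])
  also have "\<dots> = - v_plus * (c * ?I + c * ln c * (\<integral>\<omega>. f_minus \<omega> \<partial>lebesgue))"
    unfolding ln_avg using integrable integrable_ln
    by (subst Bochner_Integration.integral_add) simp_all
  \<comment> \<open>Regrouped so that \<open>v_plus * c\<close> and the normalization integral
    appear verbatim for rewriting.\<close>
  also have "\<dots> = - (v_plus * c) * ?I - (v_plus * c * (\<integral>\<omega>. f_minus \<omega> \<partial>lebesgue)) * ln c"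
    by (simp add: algebra_simps)
  also have "\<dots> = - v_minus * ?I - ln c"
    unfolding vc normalized by simp
  also have "- v_minus * ?I = S_minus"
    unfolding S_minus volumes by (rule gas_entropy_homogeneous[OF minus integrable_ln, symmetric])
  also have "S_minus - ln c = S_minus + ln (v_plus / v_minus)"
    using v_minus_pos v_plus_pos by (simp add: c_def ln_div)
  finally show ?thesis .
qed

end
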